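(* The difference scheme $$\mathbb{P}^{(\theta)}_{(\omega)}(\Delta_{0t_{j+1}})y_i=\Lambda y_i^{j+1}+\varphi_i^{j+1},\quad i=0,1,\dots,N,\ j=0,1,\dots,j_0-1,\qquad y_i^0=u_0(x_i),\quad i=0,1,\dots,N,$$ (with the operator $\Lambda$ and right-hand side $\varphi$ for the Robin problem defined in the context) is absolutely stable, and its solution satisfies (for all mesh steps $h=l/N$, $\tau=T/j_0$, with no restriction relating them, and every $j=0,1,\dots,j_0-1$) the a priori estimate $$\int_\alpha^\beta\sum_{r=1}^m\Big[\frac{\omega_r(x_i,\gamma)}{\Gamma(2-\theta_r(x_i,\gamma))},\ \sum_{s=0}^{j}\big(t_{j-s+1}^{1-\theta_r(x_i,\gamma)}-t_{j-s}^{1-\theta_r(x_i,\gamma)}\big)(y_i^{s+1})^2\Big]d\gamma+\gamma_1\sum_{s=0}^{j}\big(\|y_{\bar x}^{s+1}]|_0^2+(y_0^{s+1})^2+(y_N^{s+1})^2\big)\tau$$ $$\le\frac{\delta_1}{\gamma_1}\sum_{s=0}^{j}\big((\tilde\mu_1^{s+1})^2+(\tilde\mu_2^{s+1})^2+\|\varphi^{s+1}\|_0^2\big)\tau+\int_\alpha^\beta\sum_{r=1}^m\Big[\frac{\omega_r(x_i,\gamma)\,t_{j+1}^{1-\theta_r(x_i,\gamma)}}{\Gamma(2-\theta_r(x_i,\gamma))},\ u_0^2(x_i)\Big]d\gamma,$$ where $\gamma_1=\min\{c_1,\beta_0\}$ and $\delta_1=\max\{1+l,l^2\}$.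
   Context: Let $l,T>0$, $\alpha<\beta$ real, $m\ge1$ an integer, $\bar Q_T=[0,l]\times[0,T]$. For $r=1,\dots,m$: $\theta_r$ is continuous on $[0,l]\times[\alpha,\beta]$ with $0<\theta_r<1$; $\omega_r\ge0$ on $[0,l]\times[\alpha,\beta]$ with $\omega_r(x,\cdot)$ integrable on $[\alpha,\beta]$ for each $x$; and $\int_\alpha^\beta\sum_{r=1}^m\omega_r(x,\gamma)\,d\gamma>0$ for all $x\in[0,l]$. The functions $k,q,f$ on $\bar Q_T$ satisfy $0<c_1\le k\le c_2$, $q\ge0$ (constants $c_1,c_2$), and $\beta_i,\mu_i\in C[0,T]$ with $\beta_i(t)\ge\beta_0>0$ on $[0,T]$, $i=1,2$. Standing assumption of the difference setting: the problem $\int_\alpha^\beta\sum_{r=1}^m\omega_r(x,\gamma)\,\partial_{0t}^{\theta_r(x,\gamma)}u\,d\gamma=(ku_x)_x-qu+f$ for $0<x<l$, $0<t\le T$, $k(0,t)u_x(0,t)=\beta_1(t)u(0,t)-\mu_1(t)$, $-k(l,t)u_x(l,t)=\beta_2(t)u(l,t)-\mu_2(t)$, $u(x,0)=u_0(x)$, where $\partial_{0t}^\theta u(x,t)=\frac1{\Gamma(1-\theta)}\int_0^t u_\eta(x,\eta)(t-\eta)^{-\theta}d\eta$ is the Caputo derivative, has a solution $u\in C^{4,3}(\bar Q_T)$ (continuous with its partial derivatives up to order $4$ in $x$ and $3$ in $t$), and $k,q,f,u_0$ are (at least) continuous. Grid: $x_i=ih$, $i=0,\dots,N$, $hN=l$;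 $t_j=j\tau$, $j=0,\dots,j_0$, $\tau j_0=T$; $x_{i-1/2}=x_i-h/2$; $y_i^j$ is the value of the grid function $y$ at $(x_i,t_j)$. Set $$\mathbb{P}^{(\theta)}_{(\omega)}(\Delta_{0t_{j+1}})y_i=\int_\alpha^\beta\sum_{r=1}^m\omega_r(x_i,\gamma)\,\Delta_{0t_{j+1}}^{\theta_r(x_i,\gamma)}y_i\,d\gamma,$$ $$\Delta_{0t_{j+1}}^{\theta}y_i=\frac1{\Gamma(2-\theta)}\sum_{s=0}^{j}\big(t_{j-s+1}^{1-\theta}-t_{j-s}^{1-\theta}\big)\frac{y_i^{s+1}-y_i^s}{\tau}.$$ Write $v_{\bar x,i}=(v_i-v_{i-1})/h$, $v_{x,i}=(v_{i+1}-v_i)/h$, and, at time level $j+1$, $a_i=k(x_{i-1/2},t_{j+1})$, $d_i=q(x_i,t_{j+1})$, $f_i=f(x_i,t_{j+1})$, $\tilde\beta_1=\beta_1(t_{j+1})+0.5hd_0$, $\tilde\beta_2=\beta_2(t_{j+1})+0.5hd_N$, $\tilde\mu_1=\tilde\mu_1^{j+1}=\mu_1(t_{j+1})+0.5hf_0$, $\tilde\mu_2=\tilde\mu_2^{j+1}=\mu_2(t_{j+1})+0.5hf_N$. Then (all quantities at level $j+1$) $$\Lambda y_0=\frac{a_1y_{x,0}-\tilde\beta_1y_0}{0.5h},\qquad \Lambda y_i=(ay_{\bar x})_{x,i}-d_iy_i\ (1\le i\le N-1),\qquad \Lambda y_N=\frac{-a_Ny_{\bar x,N}-\tilde\beta_2y_N}{0.5h},$$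 $$\varphi_0=\frac{2\tilde\mu_1}{h},\qquad \varphi_i=f_i\ (1\le i\le N-1),\qquad \varphi_N=\frac{2\tilde\mu_2}{h}.$$ Inner products and norms (over the spatial index $i$): $[y,v]=\sum_{i=1}^{N-1}y_iv_ih+0.5y_0v_0h+0.5y_Nv_Nh$, $\|y\|_0^2=\sum_{i=1}^{N-1}y_i^2h$, $\|y]|_0^2=\sum_{i=1}^{N}y_i^2h$. "Absolutely stable" means that the stability estimate displayed in the claim holds for all steps $h,\tau$ without any restriction on their relative size. *)

theory Defs
  imports "HOL-Analysis.Analysis"
begin

section \<open>The continuous problem\<close>

text \<open>
  The class of functions on the closed rectangle that are continuous together with their pure
  partial derivatives up to order \<open>p\<close> in \<open>x\<close> and up to order \<open>n\<close> in \<open>t\<close>.  Derivatives at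
  boundary points are one-sided.  No mixed derivatives are required, so this class contains the
  one defined by requiring them too.
\<close>

definition C_xt :: "nat \<Rightarrow> nat \<Rightarrow> real \<Rightarrow> real \<Rightarrow> (real \<Rightarrow> real \<Rightarrow> real) \<Rightarrow> bool" where
  "C_xt p n l T u \<longleftrightarrow>
    (\<exists>D E :: nat \<Rightarrow> real \<Rightarrow> real \<Rightarrow> real.
       D 0 = u \<and> E 0 = u \<and>
       (\<forall>a\<le>p. continuous_on ({0..l} \<times> {0..T}) (\<lambda>(x, t). D a x t)) \<and>
       (\<forall>b\<le>n. continuous_on ({0..l} \<times> {0..T}) (\<lambda>(x, t). E b x t)) \<and>
       (\<forall>a<p. \<forall>x\<in>{0..l}. \<forall>t\<in>{0..T}.
          ((\<lambda>\<xi>. D a \<xi> t) has_real_derivative D (Suc a) x t) (at x within {0..l})) \<and>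
       (\<forall>b<n. \<forall>x\<in>{0..l}. \<forall>t\<in>{0..T}.
          ((\<lambda>\<eta>. E b x \<eta>) has_real_derivative E (Suc b) x t) (at t within {0..T})))"

definition dx :: "real \<Rightarrow> (real \<Rightarrow> real \<Rightarrow> real) \<Rightarrow> real \<Rightarrow> real \<Rightarrow> real" where
  "dx l u x t = vector_derivative (\<lambda>\<xi>. u \<xi> t) (at x within {0..l})"

definition caputo :: "real \<Rightarrow> (real \<Rightarrow> real) \<Rightarrow> real \<Rightarrow> real" where
  "caputo \<theta> v t = 1 / Gamma (1 - \<theta>) *
     integral {0..t} (\<lambda>\<eta>. vector_derivative v (at \<eta> within {0..t}) * (t - \<eta>) powr (- \<theta>))"

text \<open>
  The equation is stated with \<open>has_real_derivative\<close>, so that the differentiability of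
  \<open>k u\<^sub>x\<close> in \<open>x\<close> is part of being a solution.
\<close>

definition robin_solution ::
  "real \<Rightarrow> real \<Rightarrow> real \<Rightarrow> real \<Rightarrow> nat \<Rightarrow>
   (nat \<Rightarrow> real \<Rightarrow> real \<Rightarrow> real) \<Rightarrow> (nat \<Rightarrow> real \<Rightarrow> real \<Rightarrow> real) \<Rightarrow>
   (real \<Rightarrow> real \<Rightarrow> real) \<Rightarrow> (real \<Rightarrow> real \<Rightarrow> real) \<Rightarrow> (real \<Rightarrow> real \<Rightarrow> real) \<Rightarrow>
   (real \<Rightarrow> real) \<Rightarrow> (real \<Rightarrow> real) \<Rightarrow> (real \<Rightarrow> real) \<Rightarrow> (real \<Rightarrow> real) \<Rightarrow>
   (real \<Rightarrow> real) \<Rightarrow> (real \<Rightarrow> real \<Rightarrow> real) \<Rightarrow> bool" where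
  "robin_solution l T \<alpha> \<beta> m \<omega> \<theta> k q f \<beta>\<^sub>1 \<beta>\<^sub>2 \<mu>\<^sub>1 \<mu>\<^sub>2 u\<^sub>0 u \<longleftrightarrow>
     (\<forall>x\<in>{0<..<l}. \<forall>t\<in>{0<..T}.
        ((\<lambda>\<xi>. k \<xi> t * dx l u \<xi> t) has_real_derivative
           integral {\<alpha>..\<beta>} (\<lambda>\<gamma>. \<Sum>r=1..m. \<omega> r x \<gamma> * caputo (\<theta> r x \<gamma>) (u x) t)
             + q x t * u x t - f x t) (at x)) \<and>
     (\<forall>t\<in>{0<..T}. k 0 t * dx l u 0 t = \<beta>\<^sub>1 t * u 0 t - \<mu>\<^sub>1 t) \<and>
     (\<forall>t\<in>{0<..T}. - (k l t * dx l u l t) = \<beta>\<^sub>2 t * u l t - \<mu>\<^sub>2 t) \<and>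
     (\<forall>x\<in>{0..l}. u x 0 = u\<^sub>0 x)"


section \<open>The difference scheme\<close>

text \<open>
  A space-time grid function \<open>y\<close> has the value \<open>y i j\<close> at the node \<open>(i h, j \<tau>)\<close>.
\<close>

definition node :: "real \<Rightarrow> nat \<Rightarrow> real" where
  "node s i = real i * s"

definition bwd :: "real \<Rightarrow> (nat \<Rightarrow> real) \<Rightarrow> nat \<Rightarrow> real" where
  "bwd h v i = (v i - v (i - 1)) / h"

definition fwd :: "real \<Rightarrow> (nat \<Rightarrow> real) \<Rightarrow> nat \<Rightarrow> real" where
  "fwd h v i = (v (i + 1) - v i) / h"

definition inner_h :: "real \<Rightarrow> nat \<Rightarrow> (nat \<Rightarrow> real) \<Rightarrow> (nat \<Rightarrow> real) \<Rightarrow> real" where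
  "inner_h h N y v = (\<Sum>i=1..N-1. y i * v i * h) + 0.5 * y 0 * v 0 * h + 0.5 * y N * v N * h"

text \<open>Squares of the norm over the interior nodes and of the norm that includes the right end node.\<close>

definition norm0_sq :: "real \<Rightarrow> nat \<Rightarrow> (nat \<Rightarrow> real) \<Rightarrow> real" where
  "norm0_sq h N y = (\<Sum>i=1..N-1. (y i)\<^sup>2 * h)"

definition normr_sq :: "real \<Rightarrow> nat \<Rightarrow> (nat \<Rightarrow> real) \<Rightarrow> real" where
  "normr_sq h N y = (\<Sum>i=1..N. (y i)\<^sup>2 * h)"

text \<open>
  The weights \<open>t\<^bsub>n+1\<^esub>\<^bsup>1-\<theta>\<^esup> - t\<^bsub>n\<^esub>\<^bsup>1-\<theta>\<^esup>\<close>; for \<open>n = 0\<close> the second power is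
  \<open>0 powr (1 - \<theta>) = 0\<close>.
\<close>

definition tweight :: "real \<Rightarrow> real \<Rightarrow> nat \<Rightarrow> real" where
  "tweight \<tau> \<theta> n = node \<tau> (n + 1) powr (1 - \<theta>) - node \<tau> n powr (1 - \<theta>)"

text \<open>The discrete Caputo derivative at the time level \<open>j + 1\<close>.\<close>

definition caputo_diff :: "real \<Rightarrow> nat \<Rightarrow> real \<Rightarrow> (nat \<Rightarrow> real) \<Rightarrow> real" where
  "caputo_diff \<tau> j \<theta> v =
     1 / Gamma (2 - \<theta>) * (\<Sum>s=0..j. tweight \<tau> \<theta> (j - s) * ((v (s + 1) - v s) / \<tau>))"

definition distr_diff ::
  "real \<Rightarrow> real \<Rightarrow> nat \<Rightarrow> (nat \<Rightarrow> real \<Rightarrow> real \<Rightarrow> real) \<Rightarrow> (nat \<Rightarrow> real \<Rightarrow> real \<Rightarrow> real) \<Rightarrow>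
   real \<Rightarrow> real \<Rightarrow> nat \<Rightarrow> (nat \<Rightarrow> nat \<Rightarrow> real) \<Rightarrow> nat \<Rightarrow> real" where
  "distr_diff \<alpha> \<beta> m \<omega> \<theta> h \<tau> j y i =
     integral {\<alpha>..\<beta>} (\<lambda>\<gamma>. \<Sum>r=1..m.
       \<omega> r (node h i) \<gamma> * caputo_diff \<tau> j (\<theta> r (node h i) \<gamma>) (y i))"

text \<open>The arguments \<open>\<mu>t\<^sub>1\<close>, \<open>\<beta>t\<^sub>1\<close>, etc. below stand for the corrected boundary data at one time level.\<close>

definition robin_op ::
  "real \<Rightarrow> nat \<Rightarrow> (nat \<Rightarrow> real) \<Rightarrow> (nat \<Rightarrow> real) \<Rightarrow> real \<Rightarrow> real \<Rightarrow> (nat \<Rightarrow> real) \<Rightarrow> nat \<Rightarrow> real" where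
  "robin_op h N a d \<beta>t\<^sub>1 \<beta>t\<^sub>2 v i =
     (if i = 0 then (a 1 * fwd h v 0 - \<beta>t\<^sub>1 * v 0) / (0.5 * h)
      else if i = N then (- a N * bwd h v N - \<beta>t\<^sub>2 * v N) / (0.5 * h)
      else fwd h (\<lambda>i. a i * bwd h v i) i - d i * v i)"

definition robin_rhs :: "real \<Rightarrow> nat \<Rightarrow> (nat \<Rightarrow> real) \<Rightarrow> real \<Rightarrow> real \<Rightarrow> nat \<Rightarrow> real" where
  "robin_rhs h N g \<mu>t\<^sub>1 \<mu>t\<^sub>2 i =
     (if i = 0 then 2 * \<mu>t\<^sub>1 / h else if i = N then 2 * \<mu>t\<^sub>2 / h else g i)"

text \<open>
  The corrections \<open>\<beta>\<^sub>1 + 0.5 h q\<^sub>0\<close> and \<open>\<mu>\<^sub>1 + 0.5 h f\<^sub>0\<close> (and likewise at the right end): a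
  boundary datum \<open>b\<close> at \<open>t\<close> corrected by a coefficient \<open>g\<close> at the boundary point \<open>x\<close>.
\<close>

definition bcorr :: "real \<Rightarrow> (real \<Rightarrow> real) \<Rightarrow> (real \<Rightarrow> real \<Rightarrow> real) \<Rightarrow> real \<Rightarrow> real \<Rightarrow> real" where
  "bcorr h b g x t = b t + 0.5 * h * g x t"

definition Lambda_op ::
  "real \<Rightarrow> nat \<Rightarrow> real \<Rightarrow> (real \<Rightarrow> real \<Rightarrow> real) \<Rightarrow> (real \<Rightarrow> real \<Rightarrow> real) \<Rightarrow>
   (real \<Rightarrow> real) \<Rightarrow> (real \<Rightarrow> real) \<Rightarrow> real \<Rightarrow> (nat \<Rightarrow> real) \<Rightarrow> nat \<Rightarrow> real" where
  "Lambda_op h N l k q \<beta>\<^sub>1 \<beta>\<^sub>2 t =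
     robin_op h N (\<lambda>i. k (node h i - h / 2) t) (\<lambda>i. q (node h i) t)
       (bcorr h \<beta>\<^sub>1 q 0 t) (bcorr h \<beta>\<^sub>2 q l t)"

definition phi_rhs ::
  "real \<Rightarrow> nat \<Rightarrow> real \<Rightarrow> (real \<Rightarrow> real \<Rightarrow> real) \<Rightarrow> (real \<Rightarrow> real) \<Rightarrow> (real \<Rightarrow> real) \<Rightarrow>
   real \<Rightarrow> nat \<Rightarrow> real" where
  "phi_rhs h N l f \<mu>\<^sub>1 \<mu>\<^sub>2 t =
     robin_rhs h N (\<lambda>i. f (node h i) t) (bcorr h \<mu>\<^sub>1 f 0 t) (bcorr h \<mu>\<^sub>2 f l t)"

definition scheme_solution ::
  "real \<Rightarrow> real \<Rightarrow> real \<Rightarrow> nat \<Rightarrow>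
   (nat \<Rightarrow> real \<Rightarrow> real \<Rightarrow> real) \<Rightarrow> (nat \<Rightarrow> real \<Rightarrow> real \<Rightarrow> real) \<Rightarrow>
   (real \<Rightarrow> real \<Rightarrow> real) \<Rightarrow> (real \<Rightarrow> real \<Rightarrow> real) \<Rightarrow> (real \<Rightarrow> real \<Rightarrow> real) \<Rightarrow>
   (real \<Rightarrow> real) \<Rightarrow> (real \<Rightarrow> real) \<Rightarrow> (real \<Rightarrow> real) \<Rightarrow> (real \<Rightarrow> real) \<Rightarrow> (real \<Rightarrow> real) \<Rightarrow>
   real \<Rightarrow> real \<Rightarrow> nat \<Rightarrow> nat \<Rightarrow> (nat \<Rightarrow> nat \<Rightarrow> real) \<Rightarrow> bool" where
  "scheme_solution l \<alpha> \<beta> m \<omega> \<theta> k q f \<beta>\<^sub>1 \<beta>\<^sub>2 \<mu>\<^sub>1 \<mu>\<^sub>2 u\<^sub>0 h \<tau> N j\<^sub>0 y \<longleftrightarrow>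
     (\<forall>i\<le>N. \<forall>j<j\<^sub>0.
        distr_diff \<alpha> \<beta> m \<omega> \<theta> h \<tau> j y i =
          Lambda_op h N l k q \<beta>\<^sub>1 \<beta>\<^sub>2 (node \<tau> (j + 1)) (\<lambda>i. y i (j + 1)) i
          + phi_rhs h N l f \<mu>\<^sub>1 \<mu>\<^sub>2 (node \<tau> (j + 1)) i) \<and>
     (\<forall>i\<le>N. y i 0 = u\<^sub>0 (node h i))"

end

theory Submission
  imports Defs
begin

text \<open>
  The scheme at level \<open>n + 1\<close> is tested with \<open>2 \<tau> y\<^bsup>n+1\<^esup>\<close> and summed over the levels.  Since the
  weights of the discrete Caputo derivative \<open>\<Delta>\<close> are positive and decreasing,
  \<open>2 y\<^bsup>n+1\<^esup> \<Delta> y \<ge> \<Delta> (y\<^sup>2)\<close>, and the sum of \<open>\<Delta> (y\<^sup>2)\<close> over the levels telescopes to exactly the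
  first term on the left of the claim minus the initial term on the right.  Summation by parts
  bounds the spatial operator by \<open>-\<gamma>\<^sub>1\<close> times the discrete energy; of the resulting \<open>2 \<gamma>\<^sub>1\<close>, one
  half absorbs the right-hand side through Young's inequality and a discrete Poincare inequality
  with constant \<open>\<delta>\<^sub>1\<close>.
\<close>

section \<open>Sign and monotonicity of the time weights\<close>

text \<open>This is midpoint concavity of the power. The weighted arithmetic-geometric mean
  inequality supplies the tangent line at the midpoint \<open>c\<close>; adding it at two points
  symmetric about \<open>c\<close> cancels the slope.\<close>

lemma powr_second_difference_nonpos:
  fixes x d p :: real
  assumes "0 \<le> x" "0 < d" "0 \<le> p" "p \<le> 1"
  shows "(x + 2 * d) powr p - (x + d) powr p \<le> (x + d) powr p - x powr p"
proof -
  define c where "c = x + d"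
  have c: "c > 0" using assms by (simp add: c_def)
  have young: "z powr p * c powr (1 - p) \<le> p * z + (1 - p) * c" if "z \<ge> 0" for z
  \<comment> \<open>Young's inequality is applied to positive numbers; at \<open>z = 0\<close> the
    left side vanishes because \<open>0 powr p = 0\<close>, also for \<open>p = 0\<close>.\<close>
  proof (cases "z = 0")
    case True
    then show ?thesis using assms c by simp
  next
    case False
    then show ?thesis using Youngs_inequality_0[of p "1 - p" z c] assms c that by simp
  qed
  have "(x powr p + (x + 2 * d) powr p) * c powr (1 - p) \<le> 2 * c"
    using young[of x] young[of "x + 2 * d"] assms by (simp add: c_def algebra_simps)
  also have "\<dots> = (2 * c powr p) * c powr (1 - p)"
    using c by (simp flip: powr_add)
  finally have "x powr p + (x + 2 * d) powr p \<le> 2 * c powr p"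
    using c by (simp add: mult_le_cancel_right)
  then show ?thesis by (simp add: c_def)
qed

lemma tweight_nonneg:
  assumes "0 \<le> \<tau>" "\<theta> \<le> 1"
  shows "0 \<le> tweight \<tau> \<theta> n"
  using assms by (auto simp: tweight_def node_def intro!: powr_mono2 mult_right_mono)

text \<open>The weights are consecutive increments of the concave function
  \<open>z powr (1 - \<theta>)\<close> on an equidistant grid.\<close>

lemma tweight_antimono:
  assumes "0 < \<tau>" "0 \<le> \<theta>" "\<theta> \<le> 1"
  shows "antimono (tweight \<tau> \<theta>)"
proof (rule antimonoI)
  have "tweight \<tau> \<theta> (Suc n) \<le> tweight \<tau> \<theta> n" for n
    using powr_second_difference_nonpos[of "node \<tau> n" \<tau> "1 - \<theta>"] assms
    by (simp add: tweight_def node_def algebra_simps)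
  then show "tweight \<tau> \<theta> n' \<le> tweight \<tau> \<theta> n" if "n \<le> n'" for n n'
    using lift_Suc_antimono_le that by blast
qed

section \<open>Energy inequality for the discrete Caputo derivative\<close>

text \<open>Abel summation moves the differences from \<open>g\<close> to \<open>b\<close>: the
  terms \<open>b 0 * g 0\<close> and \<open>(b (Suc s) - b s) * g (Suc s)\<close> are nonnegative,
  and only the last boundary term remains.\<close>

lemma weighted_decrements_ge:
  fixes b g :: "nat \<Rightarrow> real"
  assumes "mono b" "0 \<le> b 0" "\<And>s. 0 \<le> g s"
  shows "- (b n * g (Suc n)) \<le> (\<Sum>s=0..n. b s * (g s - g (Suc s)))"
proof (induction n)
  case 0
  then show ?case using assms(2) assms(3)[of 0] by (simp add: algebra_simps)
next
  case (Suc n)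
  have "b n * g (Suc n) \<le> b (Suc n) * g (Suc n)"
    using assms(1,3) by (intro mult_right_mono) (auto simp: mono_def)
  with Suc show ?case by (simp add: algebra_simps)
qed

text \<open>With \<open>e\<^sub>s = v\<^bsub>j+1\<^esub> - v\<^sub>s\<close>, the difference of the two sides is \<open>\<Sum>\<^sub>s b\<^sub>s (e\<^sub>s\<^sup>2 - e\<^bsub>s+1\<^esub>\<^sup>2)\<close>.\<close>

lemma weighted_differences_of_squares_le:
  fixes b v :: "nat \<Rightarrow> real"
  assumes "mono b" "0 \<le> b 0"
  shows "(\<Sum>s=0..j. b s * ((v (s + 1))\<^sup>2 - (v s)\<^sup>2))
         \<le> 2 * v (j + 1) * (\<Sum>s=0..j. b s * (v (s + 1) - v s))"
proof -
  let ?g = "\<lambda>s. (v (j + 1) - v s)\<^sup>2"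
  \<comment> \<open>The remaining boundary term vanishes since
    \<open>?g (Suc j) = 0\<close>.\<close>
  have "0 \<le> (\<Sum>s=0..j. b s * (?g s - ?g (Suc s)))"
    using weighted_decrements_ge[OF assms, of ?g j] by simp
  also have "\<dots> = 2 * v (j + 1) * (\<Sum>s=0..j. b s * (v (s + 1) - v s))
                 - (\<Sum>s=0..j. b s * ((v (s + 1))\<^sup>2 - (v s)\<^sup>2))"
    unfolding sum_distrib_left sum_subtractf[symmetric]
    by (intro sum.cong) (auto simp: power2_eq_square algebra_simps)
  finally show ?thesis by simp
qed

text \<open>Let S(n) be the sum of \<open>w (n - s) * v (s + 1)\<close> over s up to n. The inner
  sum at level n is S(n) - S(n-1) - \<open>w n * v 0\<close>. Summing over n telescopes both S and
  \<open>w\<close>, the latter to \<open>W (j + 1)\<close> because \<open>W 0 = 0\<close>.\<close>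

lemma sum_convolution_differences:
  fixes W v :: "nat \<Rightarrow> real"
  assumes "W 0 = 0"
  defines "w \<equiv> \<lambda>n. W (n + 1) - W n"
  shows "(\<Sum>n=0..j. \<Sum>s=0..n. w (n - s) * (v (s + 1) - v s))
         = (\<Sum>s=0..j. w (j - s) * v (s + 1)) - W (j + 1) * v 0"
proof (induction j)
  case 0
  then show ?case using assms by (simp add: algebra_simps)
next
  case (Suc j)
  have "(\<Sum>s=0..Suc j. w (Suc j - s) * v s)
        = w (Suc j) * v 0 + (\<Sum>s=0..j. w (j - s) * v (s + 1))"
    by (subst sum.atLeast0_atMost_Suc_shift) simp
  then have "(\<Sum>s=0..Suc j. w (Suc j - s) * (v (s + 1) - v s))
        = (\<Sum>s=0..Suc j. w (Suc j - s) * v (s + 1))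
          - (\<Sum>s=0..j. w (j - s) * v (s + 1)) - w (Suc j) * v 0"
    by (simp only: right_diff_distrib sum_subtractf)
  moreover have "w (Suc j) * v 0 = W (Suc j + 1) * v 0 - W (j + 1) * v 0"
    by (simp add: w_def algebra_simps)
  ultimately show ?case using Suc by (simp only: sum.atLeast0_atMost_Suc)
qed

text \<open>The inequality for squares is summed over the levels, and the convolution identity is
  applied to the squares with \<open>W n = node \<tau> n powr (1 - \<theta>)\<close>. The factor
  \<open>\<tau>\<close> cancels the step in the difference quotient.\<close>

lemma caputo_diff_energy:
  assumes "0 < \<tau>" "0 \<le> \<theta>" "\<theta> \<le> 1"
  shows "((\<Sum>s=0..j. tweight \<tau> \<theta> (j - s) * (v (s + 1))\<^sup>2)
            - node \<tau> (j + 1) powr (1 - \<theta>) * (v 0)\<^sup>2) / Gamma (2 - \<theta>)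
         \<le> (\<Sum>n=0..j. 2 * \<tau> * v (n + 1) * caputo_diff \<tau> n \<theta> v)"
proof -
  have G: "Gamma (2 - \<theta>) > 0" using assms by simp
  have "(\<Sum>s=0..j. tweight \<tau> \<theta> (j - s) * (v (s + 1))\<^sup>2) - node \<tau> (j + 1) powr (1 - \<theta>) * (v 0)\<^sup>2
        = (\<Sum>n=0..j. \<Sum>s=0..n. tweight \<tau> \<theta> (n - s) * ((v (s + 1))\<^sup>2 - (v s)\<^sup>2))"
    using sum_convolution_differences[of "\<lambda>n. node \<tau> n powr (1 - \<theta>)" "\<lambda>s. (v s)\<^sup>2" j]
    by (simp add: tweight_def node_def)
  also have "\<dots> \<le> (\<Sum>n=0..j. 2 * v (n + 1) * (\<Sum>s=0..n. tweight \<tau> \<theta> (n - s) * (v (s + 1) - v s)))"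
  proof (intro sum_mono weighted_differences_of_squares_le)
    \<comment> \<open>The decreasing weights are read backwards. Truncated subtraction makes them
      constant from \<open>s = n\<close> on, so monotonicity holds on all of
      \<open>nat\<close>.\<close>
    show "mono (\<lambda>s. tweight \<tau> \<theta> (n - s))" for n
      using tweight_antimono[OF assms] by (auto simp: mono_def antimono_def)
    show "0 \<le> tweight \<tau> \<theta> (n - 0)" for n
      using assms by (simp add: tweight_nonneg)
  qed
  also have "\<dots> = Gamma (2 - \<theta>) * (\<Sum>n=0..j. 2 * \<tau> * v (n + 1) * caputo_diff \<tau> n \<theta> v)"
    using assms(1) G unfolding caputo_diff_def sum_distrib_left
    by (intro sum.cong) (auto simp: field_simps)
  finally show ?thesis using G by (simp add: field_simps)
qed

section \<open>Summation by parts for the Robin operator\<close>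

text \<open>Each flux \<open>p i\<close> belongs to the cell between the nodes \<open>i - 1\<close>
  and \<open>i\<close> and is paired once with \<open>v (i - 1)\<close> and once with
  \<open>v i\<close>; the two end terms supply the pairings that the interior sum misses.\<close>

lemma summation_by_parts_boundary:
  fixes p v :: "nat \<Rightarrow> real"
  assumes "N \<ge> 1"
  shows "(\<Sum>i=1..N-1. (p (i + 1) - p i) * v i) + p 1 * v 0 - p N * v N
         = - (\<Sum>i=1..N. p i * (v i - v (i - 1)))"
proof -
  from assms obtain n where "N = Suc n" by (cases N) auto
  moreover have "(\<Sum>i=1..n. (p (i + 1) - p i) * v i) + p 1 * v 0 - p (Suc n) * v (Suc n)
      = - (\<Sum>i=1..Suc n. p i * (v i - v (i - 1)))" for n
    by (induction n) (simp_all add: algebra_simps)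
  ultimately show ?thesis by simp
qed

text \<open>Discrete Green identity. The half weights of \<open>inner_h\<close> cancel the
  denominators \<open>0.5 * h\<close> of the boundary rows, which therefore contribute exactly the
  end fluxes required by summation by parts.\<close>

lemma inner_robin_op:
  assumes "N \<ge> 1" "0 < h"
  shows "inner_h h N (robin_op h N a d b\<^sub>1 b\<^sub>2 v) v
         = - (\<Sum>i=1..N. a i * (bwd h v i)\<^sup>2 * h) - (\<Sum>i=1..N-1. d i * (v i)\<^sup>2 * h)
           - b\<^sub>1 * (v 0)\<^sup>2 - b\<^sub>2 * (v N)\<^sup>2"
proof -
  let ?p = "\<lambda>i. a i * bwd h v i"
  have interior: "(\<Sum>i=1..N-1. robin_op h N a d b\<^sub>1 b\<^sub>2 v i * v i * h)
      = (\<Sum>i=1..N-1. (?p (i + 1) - ?p i) * v i) - (\<Sum>i=1..N-1. d i * (v i)\<^sup>2 * h)"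
    unfolding sum_subtractf[symmetric] using assms
    by (intro sum.cong) (auto simp: robin_op_def fwd_def field_simps power2_eq_square)
  have left: "0.5 * robin_op h N a d b\<^sub>1 b\<^sub>2 v 0 * v 0 * h = ?p 1 * v 0 - b\<^sub>1 * (v 0)\<^sup>2"
    using assms by (simp add: robin_op_def fwd_def bwd_def field_simps power2_eq_square)
  have right: "0.5 * robin_op h N a d b\<^sub>1 b\<^sub>2 v N * v N * h = - (?p N * v N) - b\<^sub>2 * (v N)\<^sup>2"
    using assms by (simp add: robin_op_def field_simps power2_eq_square)
  have "(\<Sum>i=1..N. ?p i * (v i - v (i - 1))) = (\<Sum>i=1..N. a i * (bwd h v i)\<^sup>2 * h)"
    using assms by (intro sum.cong) (auto simp: bwd_def power2_eq_square)
  then show ?thesis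
    using summation_by_parts_boundary[OF assms(1), of ?p v]
    unfolding inner_h_def interior left right by simp
qed

text \<open>One constant \<open>c\<close> bounds the conductivity and both boundary coefficients
  from below; this is the origin of \<open>min c\<^sub>1 \<beta>\<^sub>0\<close>.\<close>

lemma inner_robin_op_le:
  assumes "N \<ge> 1" "0 < h"
    and "\<And>i. i \<in> {1..N} \<Longrightarrow> c \<le> a i" "\<And>i. i \<in> {1..N-1} \<Longrightarrow> 0 \<le> d i" "c \<le> b\<^sub>1" "c \<le> b\<^sub>2"
  shows "inner_h h N (robin_op h N a d b\<^sub>1 b\<^sub>2 v) v
         \<le> - (c * (normr_sq h N (bwd h v) + (v 0)\<^sup>2 + (v N)\<^sup>2))"
proof -
  have "c * normr_sq h N (bwd h v) \<le> (\<Sum>i=1..N. a i * (bwd h v i)\<^sup>2 * h)"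
    unfolding normr_sq_def sum_distrib_left mult.assoc using assms
    by (intro sum_mono mult_right_mono) auto
  moreover have "0 \<le> (\<Sum>i=1..N-1. d i * (v i)\<^sup>2 * h)"
    using assms by (intro sum_nonneg) auto
  moreover have "c * (v 0)\<^sup>2 \<le> b\<^sub>1 * (v 0)\<^sup>2" "c * (v N)\<^sup>2 \<le> b\<^sub>2 * (v N)\<^sup>2"
    using assms by (auto intro: mult_right_mono)
  ultimately show ?thesis
    unfolding inner_robin_op[OF assms(1,2)] by (simp add: algebra_simps)
qed

section \<open>Discrete Poincare inequality and the right-hand side\<close>

text \<open>Telescoping followed by Cauchy-Schwarz; \<open>real (n - m) * h\<close> is the distance
  between the two nodes.\<close>

lemma grid_increment_sq_le:
  assumes "0 < h" "m \<le> n"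
  shows "(v n - v m)\<^sup>2 \<le> real (n - m) * h * (\<Sum>k=Suc m..n. (bwd h v k)\<^sup>2 * h)"
proof -
  have "v n - v m = (\<Sum>k=Suc m..n. bwd h v k * h)"
    using assms sum_telescope''[OF assms(2), of v] by (simp add: bwd_def)
  also have "\<dots>\<^sup>2 \<le> (\<Sum>k=Suc m..n. (bwd h v k * h)\<^sup>2) * card {Suc m..n}"
    by (rule sum_squared_le_sum_of_squares)
  also have "\<dots> = real (n - m) * h * (\<Sum>k=Suc m..n. (bwd h v k)\<^sup>2 * h)"
    by (simp add: sum_distrib_left sum_distrib_right power2_eq_square mult_ac)
  finally show ?thesis .
qed

text \<open>Averaging the bounds obtained from the left and from the right end node produces the
  constant \<open>1\<close>, rather than \<open>2\<close>, in front of each boundary term.\<close>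

lemma grid_value_sq_le:
  assumes "0 < h" "i \<le> N"
  shows "(v i)\<^sup>2 \<le> (v 0)\<^sup>2 + (v N)\<^sup>2 + real N * h * normr_sq h N (bwd h v)"
proof -
  have sq: "x\<^sup>2 \<le> 2 * y\<^sup>2 + 2 * (x - y)\<^sup>2" for x y :: real
  proof -
    have "0 \<le> (x - 2 * y)\<^sup>2" by simp
    then show ?thesis by (simp add: power2_eq_square algebra_simps)
  qed
  let ?S = "\<lambda>m n. \<Sum>k=Suc m..n. (bwd h v k)\<^sup>2 * h"
  \<comment> \<open>Both distances to the end nodes are enlarged to the full length, so that the two
    partial sums share one factor and can be added.\<close>
  have mono: "real n' * h * ?S m n \<le> real N * h * ?S m n" if "n' \<le> N" for n' m n
    using assms(1) that by (intro mult_right_mono sum_nonneg) auto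
  have "(v i - v 0)\<^sup>2 \<le> real N * h * ?S 0 i"
    using assms by (intro order_trans[OF grid_increment_sq_le[of h 0 i v]] mono) auto
  moreover have "(v N - v i)\<^sup>2 \<le> real N * h * ?S i N"
    using assms by (intro order_trans[OF grid_increment_sq_le[of h i N v]] mono) auto
  moreover have "?S 0 i + ?S i N = normr_sq h N (bwd h v)"
    using assms(2) sum.ub_add_nat[of 1 i "\<lambda>k. (bwd h v k)\<^sup>2 * h" "N - i"]
    by (simp add: normr_sq_def)
  then have "real N * h * ?S 0 i + real N * h * ?S i N = real N * h * normr_sq h N (bwd h v)"
    by (simp flip: distrib_left)
  moreover have "(v i - v N)\<^sup>2 = (v N - v i)\<^sup>2" by (simp add: power2_commute)
  ultimately show ?thesis using sq[of "v i" "v 0"] sq[of "v i" "v N"] by linarith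
qed

text \<open>The pointwise bound is uniform in the node, and the interior nodes carry total weight
  \<open>real (N - 1) * h\<close>, at most \<open>l\<close>. This gives one factor \<open>l\<close>;
  the second one in \<open>l\<^sup>2\<close> comes from the pointwise bound.\<close>

lemma discrete_poincare:
  assumes "0 < h" "N \<ge> 1" "real N * h = l"
  shows "norm0_sq h N v \<le> l * ((v 0)\<^sup>2 + (v N)\<^sup>2) + l\<^sup>2 * normr_sq h N (bwd h v)"
proof -
  let ?B = "(v 0)\<^sup>2 + (v N)\<^sup>2 + l * normr_sq h N (bwd h v)"
  have "0 \<le> l" using assms by auto
  have R: "0 \<le> normr_sq h N (bwd h v)"
    using assms by (auto simp: normr_sq_def intro!: sum_nonneg)
  have "norm0_sq h N v \<le> (\<Sum>i=1..N-1. ?B * h)"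
    unfolding norm0_sq_def using grid_value_sq_le[of h _ N v] assms
    by (intro sum_mono mult_right_mono) auto
  also have "\<dots> = real (N - 1) * h * ?B" by simp
  also have "\<dots> \<le> l * ?B"
    unfolding assms(3)[symmetric] using assms R \<open>0 \<le> l\<close>
    by (intro mult_right_mono) (auto intro!: add_nonneg_nonneg mult_nonneg_nonneg)
  finally show ?thesis by (simp add: power2_eq_square algebra_simps)
qed

text \<open>Young's parameter \<open>\<gamma> / \<delta>\<close> is chosen so that the Poincare
  constant \<open>\<delta>\<close> turns the \<open>v\<close> part into \<open>\<gamma>\<close>
  times the energy. In \<open>\<delta>\<close>, the entry \<open>1 + l\<close> serves the boundary
  values, 1 directly and \<open>l\<close> through the Poincare inequality, and
  \<open>l\<^sup>2\<close> serves the differences.\<close>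

lemma inner_robin_rhs_le:
  assumes "0 < h" "N \<ge> 1" "real N * h = l" "0 < \<gamma>" and \<delta>: "\<delta> = max (1 + l) (l\<^sup>2)"
  shows "2 * inner_h h N (robin_rhs h N g b\<^sub>1 b\<^sub>2) v
         \<le> \<gamma> * (normr_sq h N (bwd h v) + (v 0)\<^sup>2 + (v N)\<^sup>2)
           + \<delta> / \<gamma> * (b\<^sub>1\<^sup>2 + b\<^sub>2\<^sup>2 + norm0_sq h N (robin_rhs h N g b\<^sub>1 b\<^sub>2))"
proof -
  let ?\<phi> = "robin_rhs h N g b\<^sub>1 b\<^sub>2" and ?c = "\<gamma> / \<delta>"
  have "0 \<le> l" using assms by auto
  have \<delta>pos: "0 < \<delta>" using \<open>0 \<le> l\<close> \<delta> by (simp add: less_max_iff_disj)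
  then have c: "0 < ?c" using assms by simp
  have young: "2 * (x * y) \<le> ?c * y\<^sup>2 + \<delta> / \<gamma> * x\<^sup>2" for x y
  proof -
    have "0 \<le> (?c * y - x)\<^sup>2" by simp
    then have "?c * (2 * (x * y)) \<le> ?c * (?c * y\<^sup>2) + x\<^sup>2"
      by (simp add: power2_eq_square algebra_simps)
    then show ?thesis using assms(4) \<delta>pos by (simp add: field_simps)
  qed
  \<comment> \<open>The half weights turn the end values \<open>2 * b\<^sub>1 / h\<close> and
    \<open>2 * b\<^sub>2 / h\<close> into \<open>b\<^sub>1\<close> and
    \<open>b\<^sub>2\<close>.\<close>
  have "2 * inner_h h N ?\<phi> v
      = (\<Sum>i=1..N-1. 2 * (?\<phi> i * v i) * h) + 2 * (b\<^sub>1 * v 0) + 2 * (b\<^sub>2 * v N)"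
    using assms by (simp add: inner_h_def robin_rhs_def sum_distrib_left mult.assoc)
  also have "\<dots> \<le> (\<Sum>i=1..N-1. (?c * (v i)\<^sup>2 + \<delta> / \<gamma> * (?\<phi> i)\<^sup>2) * h)
      + (?c * (v 0)\<^sup>2 + \<delta> / \<gamma> * b\<^sub>1\<^sup>2) + (?c * (v N)\<^sup>2 + \<delta> / \<gamma> * b\<^sub>2\<^sup>2)"
    using assms by (intro add_mono sum_mono mult_right_mono young) auto
  also have "\<dots> = ?c * (norm0_sq h N v + (v 0)\<^sup>2 + (v N)\<^sup>2)
      + \<delta> / \<gamma> * (b\<^sub>1\<^sup>2 + b\<^sub>2\<^sup>2 + norm0_sq h N ?\<phi>)"
    unfolding norm0_sq_def by (simp add: sum_distrib_left sum.distrib algebra_simps)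
  also have "?c * (norm0_sq h N v + (v 0)\<^sup>2 + (v N)\<^sup>2)
      \<le> ?c * (\<delta> * (normr_sq h N (bwd h v) + (v 0)\<^sup>2 + (v N)\<^sup>2))"
  proof (intro mult_left_mono)
    have "0 \<le> normr_sq h N (bwd h v)"
      using assms by (auto simp: normr_sq_def intro!: sum_nonneg)
    then have "l\<^sup>2 * normr_sq h N (bwd h v) \<le> \<delta> * normr_sq h N (bwd h v)"
      using \<delta> by (intro mult_right_mono) auto
    moreover have "(1 + l) * ((v 0)\<^sup>2 + (v N)\<^sup>2) \<le> \<delta> * ((v 0)\<^sup>2 + (v N)\<^sup>2)"
      using \<delta> by (intro mult_right_mono) auto
    ultimately show "norm0_sq h N v + (v 0)\<^sup>2 + (v N)\<^sup>2
        \<le> \<delta> * (normr_sq h N (bwd h v) + (v 0)\<^sup>2 + (v N)\<^sup>2)"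
      using discrete_poincare[OF assms(1-3), of v] by (simp add: algebra_simps)
  qed (use c in simp)
  also have "\<dots> = \<gamma> * (normr_sq h N (bwd h v) + (v 0)\<^sup>2 + (v N)\<^sup>2)"
    using \<delta>pos by simp
  finally show ?thesis by simp
qed

section \<open>Integration over the fractional order\<close>

text \<open>Nonnegativity upgrades gauge integrability of \<open>w\<close> to absolute
  integrability, which survives multiplication by a bounded measurable function.\<close>

lemma continuous_times_integrable:
  fixes w c :: "real \<Rightarrow> real"
  assumes "w integrable_on {a..b}" "\<And>x. x \<in> {a..b} \<Longrightarrow> 0 \<le> w x" "continuous_on {a..b} c"
  shows "(\<lambda>x. w x * c x) integrable_on {a..b}"
proof -
  have "(\<lambda>x. c x * w x) absolutely_integrable_on {a..b}"
  proof (rule absolutely_integrable_bounded_measurable_product_real)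
    show "c \<in> borel_measurable (lebesgue_on {a..b})"
      using assms(3) by (rule continuous_imp_measurable_on_sets_lebesgue) simp
    show "bounded (c ` {a..b})"
      using assms(3) by (intro compact_imp_bounded compact_continuous_image) auto
    show "w absolutely_integrable_on {a..b}"
      using assms(1,2) by (rule nonnegative_absolutely_integrable_1)
  qed simp
  then show ?thesis
    by (simp add: mult.commute set_lebesgue_integral_eq_integral(1))
qed

lemma continuous_on_node_powr:
  assumes "0 < \<tau>" "continuous_on S \<theta>"
  shows "continuous_on S (\<lambda>x. node \<tau> n powr (1 - \<theta> x))"
  \<comment> \<open>For \<open>n = 0\<close> the base is zero and the function is constantly
    \<open>0\<close>; otherwise the base is positive.\<close>
  using assms by (cases "n = 0") (auto simp: node_def intro!: continuous_intros)

lemma continuous_on_tweight: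
  assumes "0 < \<tau>" "continuous_on S \<theta>"
  shows "continuous_on S (\<lambda>x. tweight \<tau> (\<theta> x) n)"
  unfolding tweight_def using assms by (intro continuous_intros continuous_on_node_powr)

text \<open>The bound keeps the argument on the positive axis, where Gamma has neither poles nor
  zeros.\<close>

lemma continuous_on_inverse_Gamma_2_minus:
  fixes \<theta> :: "'a::topological_space \<Rightarrow> real"
  assumes "continuous_on S \<theta>" "\<And>x. x \<in> S \<Longrightarrow> \<theta> x < 2"
  shows "continuous_on S (\<lambda>x. 1 / Gamma (2 - \<theta> x))"
proof -
  have "continuous_on S (\<lambda>x. Gamma (2 - \<theta> x))"
  proof (rule continuous_on_compose2[of "{0<..}" Gamma])
    show "continuous_on {0<..} (Gamma :: real \<Rightarrow> real)"
      by (intro continuous_on_Gamma) (auto elim!: nonpos_Ints_cases)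
  qed (use assms in \<open>auto intro!: continuous_intros\<close>)
  moreover have "Gamma (2 - \<theta> x) \<noteq> 0" if "x \<in> S" for x
    using Gamma_real_pos[of "2 - \<theta> x"] assms(2)[OF that] by linarith
  ultimately show ?thesis by (intro continuous_intros) auto
qed

lemma continuous_on_caputo_diff:
  assumes "0 < \<tau>" "continuous_on S \<theta>" "\<And>x. x \<in> S \<Longrightarrow> \<theta> x < 2"
  shows "continuous_on S (\<lambda>x. caputo_diff \<tau> n (\<theta> x) v)"
  unfolding caputo_diff_def using assms(1,2)
  by (intro continuous_on_mult continuous_on_inverse_Gamma_2_minus[OF assms(2,3)] continuous_on_sum
      continuous_on_tweight continuous_on_const)

text \<open>At a single node, the inequality for a fixed order is multiplied by the nonnegative
  density and integrated. Integrability is recorded for each \<open>r\<close> separately because the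
  later exchange of the integral with the spatial sum asks for it in this form.\<close>

lemma distributed_caputo_energy:
  fixes w \<theta> :: "nat \<Rightarrow> real \<Rightarrow> real" and v :: "nat \<Rightarrow> real" and j :: nat
  assumes "0 < \<tau>"
    and cont: "\<And>r. r \<in> {1..m} \<Longrightarrow> continuous_on {a..b} (\<theta> r)"
    and bounds: "\<And>r x. r \<in> {1..m} \<Longrightarrow> x \<in> {a..b} \<Longrightarrow> 0 < \<theta> r x \<and> \<theta> r x < 1"
    and nonneg: "\<And>r x. r \<in> {1..m} \<Longrightarrow> x \<in> {a..b} \<Longrightarrow> 0 \<le> w r x"
    and int: "\<And>r. r \<in> {1..m} \<Longrightarrow> w r integrable_on {a..b}"
  defines "A \<equiv> \<lambda>r x. w r x / Gamma (2 - \<theta> r x) * (\<Sum>s=0..j. tweight \<tau> (\<theta> r x) (j - s) * (v (s + 1))\<^sup>2)"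
    and "B \<equiv> \<lambda>r x. w r x * node \<tau> (j + 1) powr (1 - \<theta> r x) / Gamma (2 - \<theta> r x) * (v 0)\<^sup>2"
  shows "\<And>r. r \<in> {1..m} \<Longrightarrow> A r integrable_on {a..b}"
    and "\<And>r. r \<in> {1..m} \<Longrightarrow> B r integrable_on {a..b}"
    and "integral {a..b} (\<lambda>x. \<Sum>r=1..m. A r x) - integral {a..b} (\<lambda>x. \<Sum>r=1..m. B r x)
         \<le> (\<Sum>n=0..j. 2 * \<tau> * v (n + 1)
              * integral {a..b} (\<lambda>x. \<Sum>r=1..m. w r x * caputo_diff \<tau> n (\<theta> r x) v))"
proof -
  note prod = continuous_times_integrable[OF int nonneg]
  have lt2: "\<theta> r x < 2" if "r \<in> {1..m}" "x \<in> {a..b}" for r x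
    using bounds[OF that] by simp
  show A: "A r integrable_on {a..b}" if r: "r \<in> {1..m}" for r
  proof -
    \<comment> \<open>Regrouped so that everything except \<open>w r\<close> forms one continuous
      factor.\<close>
    have "(\<lambda>x. w r x * (1 / Gamma (2 - \<theta> r x)
        * (\<Sum>s=0..j. tweight \<tau> (\<theta> r x) (j - s) * (v (s + 1))\<^sup>2))) integrable_on {a..b}"
      using assms(1) cont[OF r] lt2[OF r]
      by (intro prod[OF r r] continuous_on_mult continuous_on_inverse_Gamma_2_minus
          continuous_on_sum continuous_on_tweight continuous_on_const)
    then show ?thesis by (simp add: A_def)
  qed
  show B: "B r integrable_on {a..b}" if r: "r \<in> {1..m}" for r
  proof -
    have "(\<lambda>x. w r x * (node \<tau> (j + 1) powr (1 - \<theta> r x) * (1 / Gamma (2 - \<theta> r x)) * (v 0)\<^sup>2))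
        integrable_on {a..b}"
      using assms(1) cont[OF r] lt2[OF r]
      by (intro prod[OF r r] continuous_on_mult continuous_on_inverse_Gamma_2_minus
          continuous_on_node_powr continuous_on_const)
    then show ?thesis by (simp add: B_def mult.assoc)
  qed
  have C: "(\<lambda>x. w r x * caputo_diff \<tau> n (\<theta> r x) v) integrable_on {a..b}" if r: "r \<in> {1..m}" for r n
    using assms(1) cont[OF r] lt2[OF r] by (intro prod[OF r r] continuous_on_caputo_diff)
  let ?C = "\<lambda>n x. \<Sum>r=1..m. w r x * caputo_diff \<tau> n (\<theta> r x) v"
  have Ai: "(\<lambda>x. \<Sum>r=1..m. A r x) integrable_on {a..b}"
    and Bi: "(\<lambda>x. \<Sum>r=1..m. B r x) integrable_on {a..b}"
    and Ci: "\<And>n. ?C n integrable_on {a..b}"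
    using A B C by (auto intro!: integrable_sum)
  have "integral {a..b} (\<lambda>x. \<Sum>r=1..m. A r x) - integral {a..b} (\<lambda>x. \<Sum>r=1..m. B r x)
      = integral {a..b} (\<lambda>x. (\<Sum>r=1..m. A r x) - (\<Sum>r=1..m. B r x))"
    using Ai Bi by (simp add: Henstock_Kurzweil_Integration.integral_diff)
  also have "\<dots> \<le> integral {a..b} (\<lambda>x. \<Sum>n=0..j. 2 * \<tau> * v (n + 1) * ?C n x)"
  proof (rule integral_le)
    fix x assume x: "x \<in> {a..b}"
    have "(\<Sum>r=1..m. A r x) - (\<Sum>r=1..m. B r x)
        = (\<Sum>r=1..m. w r x * (((\<Sum>s=0..j. tweight \<tau> (\<theta> r x) (j - s) * (v (s + 1))\<^sup>2)
            - node \<tau> (j + 1) powr (1 - \<theta> r x) * (v 0)\<^sup>2) / Gamma (2 - \<theta> r x)))"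
      unfolding A_def B_def sum_subtractf[symmetric]
      by (intro sum.cong) (simp_all add: right_diff_distrib diff_divide_distrib mult.assoc)
    also have "\<dots> \<le> (\<Sum>r=1..m. w r x
        * (\<Sum>n=0..j. 2 * \<tau> * v (n + 1) * caputo_diff \<tau> n (\<theta> r x) v))"
    proof (intro sum_mono mult_left_mono caputo_diff_energy assms(1))
      fix r assume r: "r \<in> {1..m}"
      show "0 \<le> w r x" using nonneg[OF r x] .
      show "0 \<le> \<theta> r x" "\<theta> r x \<le> 1" using bounds[OF r x] by simp_all
    qed
    \<comment> \<open>Exchanging the sums over \<open>r\<close> and over the levels recovers the
      integrand of the distributed difference operator.\<close>
    also have "\<dots> = (\<Sum>n=0..j. 2 * \<tau> * v (n + 1) * ?C n x)"
      unfolding sum_distrib_left by (subst sum.swap) (simp add: mult_ac)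
    finally show "(\<Sum>r=1..m. A r x) - (\<Sum>r=1..m. B r x) \<le> (\<Sum>n=0..j. 2 * \<tau> * v (n + 1) * ?C n x)" .
  qed (intro integrable_sum integrable_diff integrable_on_mult_right Ai Bi Ci finite_atLeastAtMost)+
  also have "\<dots> = (\<Sum>n=0..j. 2 * \<tau> * v (n + 1) * integral {a..b} (?C n))"
    by (subst Henstock_Kurzweil_Integration.integral_sum)
       (auto intro: integrable_on_mult_right Ci[simplified])
  finally show "integral {a..b} (\<lambda>x. \<Sum>r=1..m. A r x) - integral {a..b} (\<lambda>x. \<Sum>r=1..m. B r x)
      \<le> (\<Sum>n=0..j. 2 * \<tau> * v (n + 1) * integral {a..b} (?C n))" .
qed

section \<open>Exchanging the spatial inner product with the integral\<close>

text \<open>Trapezoidal quadrature weights merge the three parts of \<open>inner_h\<close> into one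
  sum over nodes, which can be exchanged with sums over levels and with integrals.\<close>

definition trapezoid_weight :: "real \<Rightarrow> nat \<Rightarrow> nat \<Rightarrow> real" where
  "trapezoid_weight h N i = (if i = 0 \<or> i = N then h / 2 else h)"

lemma inner_h_eq_sum:
  assumes "N \<ge> 1"
  shows "inner_h h N y v = (\<Sum>i\<le>N. trapezoid_weight h N i * (y i * v i))"
proof -
  \<comment> \<open>Since \<open>N \<ge> 1\<close>, the two end nodes are distinct, and each enters
    once with half weight.\<close>
  have "{..N} = insert 0 (insert N {1..N-1})" using assms by auto
  then have "(\<Sum>i\<le>N. trapezoid_weight h N i * (y i * v i))
      = h / 2 * (y 0 * v 0) + h / 2 * (y N * v N)
        + (\<Sum>i=1..N-1. trapezoid_weight h N i * (y i * v i))"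
    using assms by (simp add: trapezoid_weight_def)
  also have "(\<Sum>i=1..N-1. trapezoid_weight h N i * (y i * v i)) = (\<Sum>i=1..N-1. y i * v i * h)"
    using assms by (intro sum.cong) (auto simp: trapezoid_weight_def)
  finally show ?thesis by (simp add: inner_h_def mult_ac)
qed

lemma inner_h_add_left: "inner_h h N (\<lambda>i. y i + z i) v = inner_h h N y v + inner_h h N z v"
  by (simp add: inner_h_def sum.distrib ring_distribs add_divide_distrib)

text \<open>The claim integrates inner products, while the energy inequality is available node by
  node; this translates between the two forms.\<close>

lemma integral_sum_inner_h:
  fixes f g :: "nat \<Rightarrow> real \<Rightarrow> nat \<Rightarrow> real"
  assumes "N \<ge> 1"
    and int: "\<And>r i. r \<in> R \<Longrightarrow> i \<le> N \<Longrightarrow> (\<lambda>x. f r x i * g r x i) integrable_on {a..b}"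
  shows "integral {a..b} (\<lambda>x. \<Sum>r\<in>R. inner_h h N (f r x) (g r x))
         = (\<Sum>i\<le>N. trapezoid_weight h N i * integral {a..b} (\<lambda>x. \<Sum>r\<in>R. f r x i * g r x i))"
\<comment> \<open>For infinite \<open>R\<close> every sum over \<open>R\<close> is zero by
  convention and both sides vanish.\<close>
proof (cases "finite R")
  case True
  have swap: "(\<lambda>x. \<Sum>r\<in>R. inner_h h N (f r x) (g r x))
      = (\<lambda>x. \<Sum>i\<le>N. trapezoid_weight h N i * (\<Sum>r\<in>R. f r x i * g r x i))"
    unfolding inner_h_eq_sum[OF assms(1)] sum_distrib_left by (subst sum.swap) simp
  have "(\<lambda>x. \<Sum>r\<in>R. f r x i * g r x i) integrable_on {a..b}" if "i \<le> N" for i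
    using int that True by (intro integrable_sum) auto
  then show ?thesis
    unfolding swap by (subst Henstock_Kurzweil_Integration.integral_sum)
      (auto intro: integrable_on_mult_right)
qed simp

section \<open>The a priori estimate\<close>

theorem theorem4:
  fixes l T \<alpha> \<beta> c\<^sub>1 c\<^sub>2 \<beta>\<^sub>0 \<gamma>\<^sub>1 \<delta>\<^sub>1 :: real
    and m :: nat
    and \<theta> \<omega> :: "nat \<Rightarrow> real \<Rightarrow> real \<Rightarrow> real"
    and k q f :: "real \<Rightarrow> real \<Rightarrow> real"
    and \<beta>\<^sub>1 \<beta>\<^sub>2 \<mu>\<^sub>1 \<mu>\<^sub>2 u\<^sub>0 :: "real \<Rightarrow> real"
  assumes "l > 0" and "T > 0" and "\<alpha> < \<beta>" and "m \<ge> 1"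
    and "\<And>r. r \<in> {1..m} \<Longrightarrow> continuous_on ({0..l} \<times> {\<alpha>..\<beta>}) (\<lambda>(x, \<gamma>). \<theta> r x \<gamma>)"
    and "\<And>r x \<gamma>. r \<in> {1..m} \<Longrightarrow> x \<in> {0..l} \<Longrightarrow> \<gamma> \<in> {\<alpha>..\<beta>} \<Longrightarrow> 0 < \<theta> r x \<gamma> \<and> \<theta> r x \<gamma> < 1"
    and "\<And>r x \<gamma>. r \<in> {1..m} \<Longrightarrow> x \<in> {0..l} \<Longrightarrow> \<gamma> \<in> {\<alpha>..\<beta>} \<Longrightarrow> 0 \<le> \<omega> r x \<gamma>"
    and "\<And>r x. r \<in> {1..m} \<Longrightarrow> x \<in> {0..l} \<Longrightarrow> \<omega> r x integrable_on {\<alpha>..\<beta>}"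
    and "\<And>x. x \<in> {0..l} \<Longrightarrow> integral {\<alpha>..\<beta>} (\<lambda>\<gamma>. \<Sum>r=1..m. \<omega> r x \<gamma>) > 0"
    and "0 < c\<^sub>1"
    and "\<And>x t. x \<in> {0..l} \<Longrightarrow> t \<in> {0..T} \<Longrightarrow> c\<^sub>1 \<le> k x t \<and> k x t \<le> c\<^sub>2"
    and "\<And>x t. x \<in> {0..l} \<Longrightarrow> t \<in> {0..T} \<Longrightarrow> 0 \<le> q x t"
    and "continuous_on ({0..l} \<times> {0..T}) (\<lambda>(x, t). k x t)"
    and "continuous_on ({0..l} \<times> {0..T}) (\<lambda>(x, t). q x t)"
    and "continuous_on ({0..l} \<times> {0..T}) (\<lambda>(x, t). f x t)"
    and "continuous_on {0..l} u\<^sub>0"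
    and "continuous_on {0..T} \<beta>\<^sub>1" and "continuous_on {0..T} \<beta>\<^sub>2"
    and "continuous_on {0..T} \<mu>\<^sub>1" and "continuous_on {0..T} \<mu>\<^sub>2"
    and "0 < \<beta>\<^sub>0"
    and "\<And>t. t \<in> {0..T} \<Longrightarrow> \<beta>\<^sub>0 \<le> \<beta>\<^sub>1 t \<and> \<beta>\<^sub>0 \<le> \<beta>\<^sub>2 t"
    and "\<exists>u. C_xt 4 3 l T u \<and> robin_solution l T \<alpha> \<beta> m \<omega> \<theta> k q f \<beta>\<^sub>1 \<beta>\<^sub>2 \<mu>\<^sub>1 \<mu>\<^sub>2 u\<^sub>0 u"
    and "\<gamma>\<^sub>1 = min c\<^sub>1 \<beta>\<^sub>0" and "\<delta>\<^sub>1 = max (1 + l) (l\<^sup>2)"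
  shows "\<forall>N j\<^sub>0 h \<tau> y.
    N \<ge> 1 \<longrightarrow> j\<^sub>0 \<ge> 1 \<longrightarrow> h = l / real N \<longrightarrow> \<tau> = T / real j\<^sub>0 \<longrightarrow>
    scheme_solution l \<alpha> \<beta> m \<omega> \<theta> k q f \<beta>\<^sub>1 \<beta>\<^sub>2 \<mu>\<^sub>1 \<mu>\<^sub>2 u\<^sub>0 h \<tau> N j\<^sub>0 y \<longrightarrow>
    (\<forall>j<j\<^sub>0.
      integral {\<alpha>..\<beta>} (\<lambda>\<gamma>. \<Sum>r=1..m.
        inner_h h N
          (\<lambda>i. \<omega> r (node h i) \<gamma> / Gamma (2 - \<theta> r (node h i) \<gamma>))
          (\<lambda>i. \<Sum>s=0..j. tweight \<tau> (\<theta> r (node h i) \<gamma>) (j - s) * (y i (s + 1))\<^sup>2))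
      + \<gamma>\<^sub>1 * (\<Sum>s=0..j.
          (normr_sq h N (bwd h (\<lambda>i. y i (s + 1))) + (y 0 (s + 1))\<^sup>2 + (y N (s + 1))\<^sup>2) * \<tau>)
      \<le> \<delta>\<^sub>1 / \<gamma>\<^sub>1 * (\<Sum>s=0..j.
          ((bcorr h \<mu>\<^sub>1 f 0 (node \<tau> (s + 1)))\<^sup>2 + (bcorr h \<mu>\<^sub>2 f l (node \<tau> (s + 1)))\<^sup>2
            + norm0_sq h N (phi_rhs h N l f \<mu>\<^sub>1 \<mu>\<^sub>2 (node \<tau> (s + 1)))) * \<tau>)
      + integral {\<alpha>..\<beta>} (\<lambda>\<gamma>. \<Sum>r=1..m.
          inner_h h N
            (\<lambda>i. \<omega> r (node h i) \<gamma> * node \<tau> (j + 1) powr (1 - \<theta> r (node h i) \<gamma>)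
                  / Gamma (2 - \<theta> r (node h i) \<gamma>))
            (\<lambda>i. (u\<^sub>0 (node h i))\<^sup>2)))"
proof (intro allI impI)
  fix N j\<^sub>0 :: nat and h \<tau> :: real and y :: "nat \<Rightarrow> nat \<Rightarrow> real" and j :: nat
  assume N: "N \<ge> 1" and j0: "j\<^sub>0 \<ge> 1" and h_def: "h = l / real N" and tau_def: "\<tau> = T / real j\<^sub>0"
    and sol: "scheme_solution l \<alpha> \<beta> m \<omega> \<theta> k q f \<beta>\<^sub>1 \<beta>\<^sub>2 \<mu>\<^sub>1 \<mu>\<^sub>2 u\<^sub>0 h \<tau> N j\<^sub>0 y" and j: "j < j\<^sub>0"
  note l = assms(1) and T = assms(2) and \<theta>_cont = assms(5) and \<theta>_bounds = assms(6)
    and \<omega>_nonneg = assms(7) and \<omega>_int = assms(8) and c1 = assms(10) and k_bounds = assms(11)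
    and q_nonneg = assms(12) and \<beta>0 = assms(21) and \<beta>_bounds = assms(22)
    and \<gamma>\<^sub>1 = assms(24) and \<delta>\<^sub>1 = assms(25)
  have h: "0 < h" and hN: "real N * h = l" using l N by (simp_all add: h_def)
  have \<tau>: "0 < \<tau>" using T j0 by (simp add: tau_def)
  have \<gamma>pos: "0 < \<gamma>\<^sub>1" using c1 \<beta>0 \<gamma>\<^sub>1 by simp
  have x: "node h i \<in> {0..l}" if "i \<le> N" for i
  proof -
    have "real i * h \<le> real N * h" using that h by (intro mult_right_mono) auto
    then show ?thesis using h hN by (simp add: node_def)
  qed
  have xh: "node h i - h / 2 \<in> {0..l}" if "i \<in> {1..N}" for i
  proof -
    have "1 * h \<le> real i * h" using that h by (intro mult_right_mono) auto
    moreover have "node h i \<le> l" using x[of i] that by simp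
    ultimately show ?thesis using h by (simp add: node_def)
  qed
  have t: "node \<tau> (n + 1) \<in> {0..T}" if "n \<le> j" for n
  proof -
    have "real (n + 1) * \<tau> \<le> real j\<^sub>0 * \<tau>" using that j \<tau> by (intro mult_right_mono) auto
    moreover have "real j\<^sub>0 * \<tau> = T" using j0 by (simp add: tau_def)
    ultimately show ?thesis using \<tau> by (simp add: node_def)
  qed
  define E where "E n = normr_sq h N (bwd h (\<lambda>i. y i (n + 1))) + (y 0 (n + 1))\<^sup>2 + (y N (n + 1))\<^sup>2" for n
  define F where "F n = (bcorr h \<mu>\<^sub>1 f 0 (node \<tau> (n + 1)))\<^sup>2 + (bcorr h \<mu>\<^sub>2 f l (node \<tau> (n + 1)))\<^sup>2
      + norm0_sq h N (phi_rhs h N l f \<mu>\<^sub>1 \<mu>\<^sub>2 (node \<tau> (n + 1)))" for n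
  define P where "P n i = distr_diff \<alpha> \<beta> m \<omega> \<theta> h \<tau> n y i" for n i
  let ?q = "trapezoid_weight h N"
  \<comment> \<open>Testing one level: doubling the operator bound gives
    \<open>-2 * \<gamma>\<^sub>1 * E n\<close>, of which the estimate of the right-hand side
    consumes half.\<close>
  have level: "2 * inner_h h N (P n) (\<lambda>i. y i (n + 1)) + \<gamma>\<^sub>1 * E n \<le> \<delta>\<^sub>1 / \<gamma>\<^sub>1 * F n" if n: "n \<le> j" for n
  proof -
    let ?t = "node \<tau> (n + 1)" and ?v = "\<lambda>i. y i (n + 1)"
    let ?L = "Lambda_op h N l k q \<beta>\<^sub>1 \<beta>\<^sub>2 ?t ?v" and ?\<phi> = "phi_rhs h N l f \<mu>\<^sub>1 \<mu>\<^sub>2 ?t"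
    have "P n i = ?L i + ?\<phi> i" if "i \<le> N" for i
      using sol that n j by (simp add: scheme_solution_def P_def)
    \<comment> \<open>The scheme holds at the nodes \<open>i \<le> N\<close>, and
      \<open>inner_h\<close> sees no others.\<close>
    then have "inner_h h N (P n) ?v = inner_h h N (\<lambda>i. ?L i + ?\<phi> i) ?v"
      using N by (simp add: inner_h_eq_sum)
    moreover have "inner_h h N ?L ?v \<le> - (\<gamma>\<^sub>1 * E n)"
      unfolding Lambda_op_def E_def
    proof (rule inner_robin_op_le[OF N h])
      show "\<gamma>\<^sub>1 \<le> k (node h i - h / 2) ?t" if "i \<in> {1..N}" for i
        using k_bounds[OF xh[OF that] t[OF n]] \<gamma>\<^sub>1 by linarith
      show "0 \<le> q (node h i) ?t" if "i \<in> {1..N-1}" for i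
      proof -
        have "i \<le> N" using that by auto
        then show ?thesis using q_nonneg[OF x t[OF n]] by simp
      qed
      \<comment> \<open>The corrections of the boundary coefficients are nonnegative, so the lower
        bound \<open>\<beta>\<^sub>0\<close> carries over.\<close>
      have "0 \<le> h * q 0 ?t" "0 \<le> h * q l ?t"
        using q_nonneg[OF _ t[OF n]] l h by simp_all
      then show "\<gamma>\<^sub>1 \<le> bcorr h \<beta>\<^sub>1 q 0 ?t" "\<gamma>\<^sub>1 \<le> bcorr h \<beta>\<^sub>2 q l ?t"
        using \<beta>_bounds[OF t[OF n]] \<gamma>\<^sub>1 by (auto simp: bcorr_def min_le_iff_disj)
    qed
    moreover have "2 * inner_h h N ?\<phi> ?v \<le> \<gamma>\<^sub>1 * E n + \<delta>\<^sub>1 / \<gamma>\<^sub>1 * F n"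
      unfolding phi_rhs_def E_def F_def by (rule inner_robin_rhs_le[OF h N hN \<gamma>pos \<delta>\<^sub>1])
    ultimately show ?thesis by (simp add: inner_h_add_left)
  qed
  \<comment> \<open>\<open>A\<close> and \<open>B\<close> are the nodal summands of the memory term
    and of the initial term, before the quadrature weights are attached.\<close>
  define A where "A r \<gamma> i = \<omega> r (node h i) \<gamma> / Gamma (2 - \<theta> r (node h i) \<gamma>)
      * (\<Sum>s=0..j. tweight \<tau> (\<theta> r (node h i) \<gamma>) (j - s) * (y i (s + 1))\<^sup>2)" for r \<gamma> i
  define B where "B r \<gamma> i = \<omega> r (node h i) \<gamma> * node \<tau> (j + 1) powr (1 - \<theta> r (node h i) \<gamma>)
      / Gamma (2 - \<theta> r (node h i) \<gamma>) * (u\<^sub>0 (node h i))\<^sup>2" for r \<gamma> i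
  have init: "y i 0 = u\<^sub>0 (node h i)" if "i \<le> N" for i
    using sol that by (simp add: scheme_solution_def)
  have \<theta>_section: "continuous_on {\<alpha>..\<beta>} (\<theta> r (node h i))" if "r \<in> {1..m}" "i \<le> N" for r i
    using continuous_on_compose2[OF \<theta>_cont[OF that(1)], of "{\<alpha>..\<beta>}" "\<lambda>\<gamma>. (node h i, \<gamma>)"]
      x[OF that(2)] by (simp add: continuous_on_Pair image_subset_iff)
  have node_energy:
    "\<And>r. r \<in> {1..m} \<Longrightarrow> (\<lambda>\<gamma>. A r \<gamma> i) integrable_on {\<alpha>..\<beta>}"
    "\<And>r. r \<in> {1..m} \<Longrightarrow> (\<lambda>\<gamma>. B r \<gamma> i) integrable_on {\<alpha>..\<beta>}"
    "integral {\<alpha>..\<beta>} (\<lambda>\<gamma>. \<Sum>r=1..m. A r \<gamma> i) - integral {\<alpha>..\<beta>} (\<lambda>\<gamma>. \<Sum>r=1..m. B r \<gamma> i)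
      \<le> (\<Sum>n=0..j. 2 * \<tau> * y i (n + 1) * P n i)" if i: "i \<le> N" for i
    using distributed_caputo_energy[where m = m and a = \<alpha> and b = \<beta> and j = j and v = "y i"
        and w = "\<lambda>r. \<omega> r (node h i)" and \<theta> = "\<lambda>r. \<theta> r (node h i)",
        OF \<tau> \<theta>_section[OF _ i] \<theta>_bounds[OF _ x[OF i]] \<omega>_nonneg[OF _ x[OF i]] \<omega>_int[OF _ x[OF i]]]
    by (simp_all add: A_def B_def P_def distr_diff_def init[OF i])
  \<comment> \<open>The nodal inequalities are added with the nonnegative quadrature
    weights.\<close>
  have "(\<Sum>i\<le>N. ?q i * integral {\<alpha>..\<beta>} (\<lambda>\<gamma>. \<Sum>r=1..m. A r \<gamma> i))
      - (\<Sum>i\<le>N. ?q i * integral {\<alpha>..\<beta>} (\<lambda>\<gamma>. \<Sum>r=1..m. B r \<gamma> i))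
      = (\<Sum>i\<le>N. ?q i * (integral {\<alpha>..\<beta>} (\<lambda>\<gamma>. \<Sum>r=1..m. A r \<gamma> i)
          - integral {\<alpha>..\<beta>} (\<lambda>\<gamma>. \<Sum>r=1..m. B r \<gamma> i)))"
    by (simp add: right_diff_distrib sum_subtractf)
  also have "\<dots> \<le> (\<Sum>i\<le>N. ?q i * (\<Sum>n=0..j. 2 * \<tau> * y i (n + 1) * P n i))"
    using h node_energy(3) by (intro sum_mono mult_left_mono) (auto simp: trapezoid_weight_def)
  \<comment> \<open>After exchanging nodes and levels, the tested scheme of each level reappears,
    and \<open>level\<close> applies to it.\<close>
  also have "\<dots> = (\<Sum>n=0..j. 2 * inner_h h N (P n) (\<lambda>i. y i (n + 1)) * \<tau>)"
    unfolding inner_h_eq_sum[OF N] sum_distrib_left sum_distrib_right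
    by (subst sum.swap) (simp add: mult_ac)
  also have "\<dots> \<le> (\<Sum>n=0..j. (\<delta>\<^sub>1 / \<gamma>\<^sub>1 * F n - \<gamma>\<^sub>1 * E n) * \<tau>)"
    using level \<tau> by (intro sum_mono mult_right_mono) (auto simp: algebra_simps)
  also have "\<dots> = \<delta>\<^sub>1 / \<gamma>\<^sub>1 * (\<Sum>n=0..j. F n * \<tau>) - \<gamma>\<^sub>1 * (\<Sum>n=0..j. E n * \<tau>)"
    by (simp add: sum_distrib_left sum_subtractf left_diff_distrib mult.assoc)
  finally have main: "(\<Sum>i\<le>N. ?q i * integral {\<alpha>..\<beta>} (\<lambda>\<gamma>. \<Sum>r=1..m. A r \<gamma> i))
        + \<gamma>\<^sub>1 * (\<Sum>n=0..j. E n * \<tau>)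
      \<le> \<delta>\<^sub>1 / \<gamma>\<^sub>1 * (\<Sum>n=0..j. F n * \<tau>)
        + (\<Sum>i\<le>N. ?q i * integral {\<alpha>..\<beta>} (\<lambda>\<gamma>. \<Sum>r=1..m. B r \<gamma> i))"
    by simp
  have A_int: "(\<Sum>i\<le>N. ?q i * integral {\<alpha>..\<beta>} (\<lambda>\<gamma>. \<Sum>r=1..m. A r \<gamma> i))
      = integral {\<alpha>..\<beta>} (\<lambda>\<gamma>. \<Sum>r=1..m. inner_h h N
          (\<lambda>i. \<omega> r (node h i) \<gamma> / Gamma (2 - \<theta> r (node h i) \<gamma>))
          (\<lambda>i. \<Sum>s=0..j. tweight \<tau> (\<theta> r (node h i) \<gamma>) (j - s) * (y i (s + 1))\<^sup>2))"
    using node_energy(1) unfolding A_def by (intro integral_sum_inner_h[OF N, symmetric])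
  have B_int: "(\<Sum>i\<le>N. ?q i * integral {\<alpha>..\<beta>} (\<lambda>\<gamma>. \<Sum>r=1..m. B r \<gamma> i))
      = integral {\<alpha>..\<beta>} (\<lambda>\<gamma>. \<Sum>r=1..m. inner_h h N
          (\<lambda>i. \<omega> r (node h i) \<gamma> * node \<tau> (j + 1) powr (1 - \<theta> r (node h i) \<gamma>)
                / Gamma (2 - \<theta> r (node h i) \<gamma>))
          (\<lambda>i. (u\<^sub>0 (node h i))\<^sup>2))"
    using node_energy(2) unfolding B_def by (intro integral_sum_inner_h[OF N, symmetric])
  show "integral {\<alpha>..\<beta>} (\<lambda>\<gamma>. \<Sum>r=1..m.
        inner_h h N
          (\<lambda>i. \<omega> r (node h i) \<gamma> / Gamma (2 - \<theta> r (node h i) \<gamma>))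
          (\<lambda>i. \<Sum>s=0..j. tweight \<tau> (\<theta> r (node h i) \<gamma>) (j - s) * (y i (s + 1))\<^sup>2))
      + \<gamma>\<^sub>1 * (\<Sum>s=0..j.
          (normr_sq h N (bwd h (\<lambda>i. y i (s + 1))) + (y 0 (s + 1))\<^sup>2 + (y N (s + 1))\<^sup>2) * \<tau>)
      \<le> \<delta>\<^sub>1 / \<gamma>\<^sub>1 * (\<Sum>s=0..j.
          ((bcorr h \<mu>\<^sub>1 f 0 (node \<tau> (s + 1)))\<^sup>2 + (bcorr h \<mu>\<^sub>2 f l (node \<tau> (s + 1)))\<^sup>2
            + norm0_sq h N (phi_rhs h N l f \<mu>\<^sub>1 \<mu>\<^sub>2 (node \<tau> (s + 1)))) * \<tau>)
      + integral {\<alpha>..\<beta>} (\<lambda>\<gamma>. \<Sum>r=1..m.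
          inner_h h N
            (\<lambda>i. \<omega> r (node h i) \<gamma> * node \<tau> (j + 1) powr (1 - \<theta> r (node h i) \<gamma>)
                  / Gamma (2 - \<theta> r (node h i) \<gamma>))
            (\<lambda>i. (u\<^sub>0 (node h i))\<^sup>2))"
    using main unfolding A_int B_int E_def F_def .
qed

end
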